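(* Let $(X,x)$ be an LMP and $R\subseteq UX\times UX$ a reflexive relation. The following are equivalent: (1) $R$ is a simulation relation on $(X,x)$; (2) $x$ is a morphism of type $(R,X)\to\mathrm{Act}\pitchfork\dot G(R,X)$ in $\mathbf{ERel}(\mathbf{Meas})$, where $\dot G$ is the codensity lifting of $\mathcal G$ along $r:\mathbf{ERel}(\mathbf{Meas})\to\mathbf{Meas}$ with single lifting parameter $R=1$, $S=(\le,G1)$.
   Context: $\mathbf{Meas}$: measurable spaces, $U$ forgetful to $\mathbf{Set}$, $\Sigma_X$ the $\sigma$-algebra. Sub-Giry monad $\mathcal G$: $GX$ is the set of subprobability measures on $X$ with $\sigma$-algebra generated by $\{\mu\mid\mu(V)\in W\}$ ($V\in\Sigma_X$, $W$ open in $[0,1]$). Fix a set $\mathrm{Act}$. An LMP is a pair $(X,x)$ with $x:X\to\mathrm{Act}\pitchfork GX$ a measurable map into the $\mathrm{Act}$-fold product of $GX$ in $\mathbf{Meas}$, with projections $\pi_a$. A reflexive relation $R\subseteq UX\times UX$ is a simulation relation on $(X,x)$ if for all $(s_1,s_2)\in R$, $a\in\mathrm{Act}$, $U\in\Sigma_X$: $R[U]=U$ implies $\pi_a(x(s_1))(U)\le\pi_a(x(s_2))(U)$, where $R[U]=\{y\mid\exists u\in U.(u,y)\in R\}$. $\mathbf{ERel}(\mathbf{Meas})$: objects $(X_0,X_1)$ with $X_1$ measurable and $X_0\subseteq UX_1\times UX_1$; morphisms measurable $f:X_1\to Y_1$ with $(f\times f)(X_0)\subseteq Y_0$. The power $\mathrm{Act}\pitchfork(Y_0,Y_1)$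 in $\mathbf{ERel}(\mathbf{Meas})$ is $(\{(f,g)\mid\forall a.(\pi_af,\pi_ag)\in Y_0\},\mathrm{Act}\pitchfork Y_1)$. The codensity lifting with single parameter $R=1$, $S=(\le,G1)$ ($\le$ the numerical order on $[0,1]$, $G1$ the Borel space of $[0,1]$) is the monad $\dot G$ lifting $\mathcal G$ with $\dot G(Y_0,Y_1)=((\dot GY)_0,GY_1)$, $(\dot GY)_0=\{(v_1,v_2)\mid\forall f\in\mathbf{ERel}(\mathbf{Meas})(Y,S).\ \int f\,dv_1\le\int f\,dv_2\}$. *)

theory Defs
  imports "HOL-Probability.Probability"
begin

text \<open>The sub-Giry space \<open>GX\<close> is the library's \<^const>\<open>subprob_algebra\<close>. The only
  divergence is at the empty space, where the library excludes the zero measure, so that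
  \<open>G\<close> of the empty space is empty instead of a singleton. This does not affect maps out of the
  empty space, hence neither the LMPs on it nor the morphisms out of an object over it.\<close>

text \<open>The product \<open>PiM\<close> consists of functions that are \<^const>\<open>undefined\<close> off \<open>Act\<close>; the
  projection \<open>\<pi>\<^sub>a\<close> is application to \<open>a \<in> Act\<close>. All maps are considered on the
  space of their domain only.\<close>

definition lmp :: "'act set \<Rightarrow> 's measure \<Rightarrow> ('s \<Rightarrow> 'act \<Rightarrow> 's measure) \<Rightarrow> bool" where
  "lmp Act X x \<longleftrightarrow> x \<in> X \<rightarrow>\<^sub>M PiM Act (\<lambda>_. subprob_algebra X)"

definition simulation_rel ::
    "'act set \<Rightarrow> 's measure \<Rightarrow> ('s \<Rightarrow> 'act \<Rightarrow> 's measure) \<Rightarrow> ('s \<times> 's) set \<Rightarrow> bool" where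
  "simulation_rel Act X x R \<longleftrightarrow>
     R \<subseteq> space X \<times> space X \<and> refl_on (space X) R \<and>
     (\<forall>(s1, s2) \<in> R. \<forall>a \<in> Act. \<forall>U \<in> sets X.
        R `` U = U \<longrightarrow> measure (x s1 a) U \<le> measure (x s2 a) U)"

type_synonym 'a erel = "('a \<times> 'a) set \<times> 'a measure"

definition erel_object :: "'a erel \<Rightarrow> bool" where
  "erel_object X \<longleftrightarrow> fst X \<subseteq> space (snd X) \<times> space (snd X)"

definition erel_hom :: "'a erel \<Rightarrow> 'b erel \<Rightarrow> ('a \<Rightarrow> 'b) set" where
  "erel_hom X Y = {f \<in> snd X \<rightarrow>\<^sub>M snd Y. map_prod f f ` fst X \<subseteq> fst Y}"

definition erel_power :: "'act set \<Rightarrow> 'a erel \<Rightarrow> ('act \<Rightarrow> 'a) erel" where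
  "erel_power Act Y =
     (let P = PiM Act (\<lambda>_. snd Y)
      in ({(f, g). f \<in> space P \<and> g \<in> space P \<and> (\<forall>a \<in> Act. (f a, g a) \<in> fst Y)}, P))"

text \<open>The lifting parameter \<open>S\<close>: a subprobability measure on the one-point space is identified
  with its total mass, which makes \<open>G1\<close> the Borel space of \<open>[0,1]\<close>.\<close>

definition unit_interval_erel :: "real erel" where
  "unit_interval_erel =
     ({(p, q). p \<in> {0..1} \<and> q \<in> {0..1} \<and> p \<le> q}, restrict_space borel {0..1})"

text \<open>Under this identification the Kleisli extension of \<open>f : Y\<^sub>1 \<rightarrow> G1\<close> sends \<open>v\<close> to
  the integral of \<open>f\<close> with respect to \<open>v\<close>.\<close>

definition codensity_lift :: "'a erel \<Rightarrow> 'a measure erel" where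
  "codensity_lift Y =
     ({(v1, v2). v1 \<in> space (subprob_algebra (snd Y)) \<and> v2 \<in> space (subprob_algebra (snd Y)) \<and>
        (\<forall>f \<in> erel_hom Y unit_interval_erel. (\<integral>y. f y \<partial>v1) \<le> (\<integral>y. f y \<partial>v2))},
      subprob_algebra (snd Y))"

lemma erel_object_unit_interval: "erel_object unit_interval_erel"
  by (auto simp: erel_object_def unit_interval_erel_def space_restrict_space)

lemma erel_object_power: "erel_object (erel_power Act Y)"
  by (auto simp: erel_object_def erel_power_def Let_def)

lemma erel_object_codensity_lift: "erel_object (codensity_lift Y)"
  by (auto simp: erel_object_def codensity_lift_def)

end

theory Submission imports Defs begin

text \<open>By the layer cake formula, the integral of a monotone \<open>f : X \<rightarrow> [0,1]\<close> is the Lebesgue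
  integral of the measures of its superlevel sets. Since \<open>R\<close> is reflexive, these are fixed
  by \<open>R[-]\<close>, so an inequality of measures on all fixed sets passes to the integrals. Conversely,
  the indicator of a fixed measurable set is a morphism into \<open>S\<close>.\<close>

text \<open>For \<open>f x\<close> nonnegative, \<open>f x\<close> is the length of the interval
  \<open>{0..f x}\<close>. Writing this length as an integral of an indicator and swapping the two
  integrals by Tonelli, for which \<open>M\<close> is taken sigma-finite, leaves the measure of a
  superlevel set for each \<open>t\<close>.\<close>

lemma nn_integral_layer_cake:
  assumes "sigma_finite_measure M" and [measurable]: "f \<in> borel_measurable M"
    and nonneg: "\<And>x. x \<in> space M \<Longrightarrow> 0 \<le> f x"
  shows "(\<integral>\<^sup>+x. ennreal (f x) \<partial>M) =
    (\<integral>\<^sup>+t. indicator {0..} t * emeasure M {x \<in> space M. t \<le> f x} \<partial>lborel)"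
proof -
  interpret sigma_finite_measure M by fact
  interpret pair_sigma_finite M lborel ..
  \<comment> \<open>The indicator of the region between 0 and the graph of \<open>f\<close>, split
    into a factor in \<open>t\<close> alone, which later leaves the integral over \<open>M\<close>,
    and a superlevel factor.\<close>
  let ?h = "\<lambda>x t. indicator {0..} t * indicator {y. t \<le> f y} x :: ennreal"
  have [measurable]: "(\<lambda>(x, t). ?h x t) \<in> borel_measurable (M \<Otimes>\<^sub>M lborel)"
    unfolding indicator_def by measurable
  have "(\<integral>\<^sup>+x. ennreal (f x) \<partial>M) = (\<integral>\<^sup>+x. emeasure lborel {0..f x} \<partial>M)"
    using nonneg by (intro nn_integral_cong) simp
  also have "\<dots> = (\<integral>\<^sup>+x. (\<integral>\<^sup>+t. indicator {0..f x} t \<partial>lborel) \<partial>M)"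
    by simp
  also have "\<dots> = (\<integral>\<^sup>+x. (\<integral>\<^sup>+t. ?h x t \<partial>lborel) \<partial>M)"
    by (intro nn_integral_cong) (auto split: split_indicator)
  also have "\<dots> = (\<integral>\<^sup>+t. (\<integral>\<^sup>+x. ?h x t \<partial>M) \<partial>lborel)"
    by (rule Fubini'[symmetric]) measurable
  also have "\<dots> =
    (\<integral>\<^sup>+t. indicator {0..} t * (\<integral>\<^sup>+x. indicator {x \<in> space M. t \<le> f x} x \<partial>M) \<partial>lborel)"
    by (simp add: nn_integral_cmult)
      (intro nn_integral_cong arg_cong2[where f = "(*)"] refl,
        auto simp flip: nn_integral_indicator intro!: nn_integral_cong split: split_indicator)
  also have "\<dots> = (\<integral>\<^sup>+t. indicator {0..} t * emeasure M {x \<in> space M. t \<le> f x} \<partial>lborel)"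
    by simp
  finally show ?thesis .
qed

text \<open>The layer cake integrands are compared pointwise in \<open>t\<close>. Boundedness of
  \<open>f\<close> on finite measures makes \<open>f\<close> integrable, so the Bochner integrals
  agree with the nonnegative ones.\<close>

lemma integral_mono_superlevel:
  fixes f :: "'a \<Rightarrow> real"
  assumes "finite_measure M" "finite_measure N" and sets_eq: "sets M = sets N"
    and f: "f \<in> borel_measurable M"
    and nonneg: "\<And>x. x \<in> space M \<Longrightarrow> 0 \<le> f x"
    and bounded: "\<And>x. x \<in> space M \<Longrightarrow> f x \<le> B"
    and le: "\<And>t. measure M {x \<in> space M. t \<le> f x} \<le> measure N {x \<in> space M. t \<le> f x}"
  shows "(\<integral>x. f x \<partial>M) \<le> (\<integral>x. f x \<partial>N)"
proof -
  interpret M: finite_measure M by fact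
  interpret N: finite_measure N by fact
  have space_eq: "space M = space N"
    using sets_eq by (rule sets_eq_imp_space_eq)
  have fN: "f \<in> borel_measurable N"
    using f measurable_cong_sets[OF sets_eq refl] by blast
  have intM: "integrable M f"
    using nonneg bounded f by (intro M.integrable_const_bound[where B = B]) auto
  have intN: "integrable N f"
    using nonneg bounded fN by (intro N.integrable_const_bound[where B = B]) (auto simp: space_eq)
  have "ennreal (\<integral>x. f x \<partial>M) = (\<integral>\<^sup>+x. ennreal (f x) \<partial>M)"
    using intM nonneg by (intro nn_integral_eq_integral[symmetric]) auto
  also have "\<dots> = (\<integral>\<^sup>+t. indicator {0..} t * emeasure M {x \<in> space M. t \<le> f x} \<partial>lborel)"
    using f nonneg by (intro nn_integral_layer_cake) (auto intro: M.sigma_finite_measure_axioms)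
  also have "\<dots> \<le> (\<integral>\<^sup>+t. indicator {0..} t * emeasure N {x \<in> space N. t \<le> f x} \<partial>lborel)"
    using le by (intro nn_integral_mono mult_left_mono)
      (auto simp: M.emeasure_eq_measure N.emeasure_eq_measure space_eq)
  also have "\<dots> = (\<integral>\<^sup>+x. ennreal (f x) \<partial>N)"
    using fN nonneg
    by (intro nn_integral_layer_cake[symmetric])
      (auto simp: space_eq intro: N.sigma_finite_measure_axioms)
  also have "\<dots> = ennreal (\<integral>x. f x \<partial>N)"
    using intN nonneg by (intro nn_integral_eq_integral) (auto simp: space_eq)
  \<comment> \<open>Passing from \<open>ennreal\<close> back to reals is sound because the integral
    over \<open>N\<close> is nonnegative.\<close>
  finally show ?thesis
    using nonneg by (simp add: space_eq)
qed

text \<open>Related points lie in \<open>space X\<close>, so their values are in [0,1] by the range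
  condition, and preservation of the relation reduces to monotonicity along
  \<open>R\<close>.\<close>

lemma erel_hom_unit_interval_iff:
  assumes "R \<subseteq> space X \<times> space X"
  shows "f \<in> erel_hom (R, X) unit_interval_erel \<longleftrightarrow>
    f \<in> borel_measurable X \<and> (\<forall>s \<in> space X. 0 \<le> f s \<and> f s \<le> 1) \<and>
    (\<forall>(s, t) \<in> R. f s \<le> f t)"
  using assms
  by (force simp: erel_hom_def unit_interval_erel_def measurable_restrict_space2_iff Pi_iff)

text \<open>Holds all the measure theory, for one pair of measures; the theorem applies it to
  \<open>x s1 a\<close> and \<open>x s2 a\<close> for each related pair and each label.\<close>

lemma codensity_lift_iff:
  assumes R: "R \<subseteq> space X \<times> space X" and "refl_on (space X) R"
    and v: "v1 \<in> space (subprob_algebra X)" "v2 \<in> space (subprob_algebra X)"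
  shows "(v1, v2) \<in> fst (codensity_lift (R, X)) \<longleftrightarrow>
    (\<forall>U \<in> sets X. R `` U = U \<longrightarrow> measure v1 U \<le> measure v2 U)"
proof -
  have sets: "sets v1 = sets X" "sets v2 = sets X"
    and sub: "subprob_space v1" "subprob_space v2"
    using v by (auto simp: space_subprob_algebra)
  have space: "space v1 = space X" "space v2 = space X"
    using sets by (auto dest: sets_eq_imp_space_eq)
  have fin: "finite_measure v1" "finite_measure v2"
    using sub by (auto simp: subprob_space_def)
  show ?thesis
  proof
    assume lift: "(v1, v2) \<in> fst (codensity_lift (R, X))"
    show "\<forall>U \<in> sets X. R `` U = U \<longrightarrow> measure v1 U \<le> measure v2 U"
    proof (intro ballI impI)
      fix U assume U: "U \<in> sets X" "R `` U = U"
      \<comment> \<open>Closure of \<open>U\<close> under \<open>R\<close> says that the indicator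
        of \<open>U\<close> never drops from 1 to 0 along \<open>R\<close>, which is its
        monotonicity.\<close>
      have "b \<in> U" if "(a, b) \<in> R" "a \<in> U" for a b
        using U(2) that by blast
      then have "(indicator U :: _ \<Rightarrow> real) \<in> erel_hom (R, X) unit_interval_erel"
        using U by (auto simp: erel_hom_unit_interval_iff[OF R] split: split_indicator)
      then have "(\<integral>y. indicator U y \<partial>v1) \<le> (\<integral>y. indicator U y \<partial>v2 :: real)"
        using lift by (auto simp: codensity_lift_def)
      then show "measure v1 U \<le> measure v2 U"
        using sets.sets_into_space[OF U(1)] by (simp add: space Int_absorb2)
    qed
  next
    assume le: "\<forall>U \<in> sets X. R `` U = U \<longrightarrow> measure v1 U \<le> measure v2 U"
    have "(\<integral>y. f y \<partial>v1) \<le> (\<integral>y. f y \<partial>v2)" if "f \<in> erel_hom (R, X) unit_interval_erel" for f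
    proof -
      have f: "f \<in> borel_measurable X" and bounds: "\<And>s. s \<in> space X \<Longrightarrow> 0 \<le> f s \<and> f s \<le> 1"
        and mono: "\<And>s t. (s, t) \<in> R \<Longrightarrow> f s \<le> f t"
        using that by (auto simp: erel_hom_unit_interval_iff[OF R])
      show ?thesis
      proof (rule integral_mono_superlevel[where B = 1])
        show "f \<in> borel_measurable v1"
          using f measurable_cong_sets[OF sets(1) refl] by blast
        fix t
        have "{s \<in> space X. t \<le> f s} \<in> sets X"
          using f by measurable
        \<comment> \<open>Monotonicity keeps \<open>R\<close>-successors in the superlevel set; by
          reflexivity each of its points is its own \<open>R\<close>-predecessor, which gives the
          other inclusion.\<close>
        moreover have "R `` {s \<in> space X. t \<le> f s} = {s \<in> space X. t \<le> f s}"
          using R mono \<open>refl_on (space X) R\<close> by (force dest: refl_onD intro: order_trans)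
        ultimately show "measure v1 {s \<in> space v1. t \<le> f s} \<le> measure v2 {s \<in> space v1. t \<le> f s}"
          using le by (simp add: space)
      qed (use fin sets bounds in \<open>auto simp: space\<close>)
    qed
    then show "(v1, v2) \<in> fst (codensity_lift (R, X))"
      using v by (auto simp: codensity_lift_def)
  qed
qed

theorem theorem4p7:
  fixes Act :: "'act set" and X :: "'s measure"
    and x :: "'s \<Rightarrow> 'act \<Rightarrow> 's measure" and R :: "('s \<times> 's) set"
  assumes "lmp Act X x"
    and "erel_object (R, X)"
    and "refl_on (space X) R"
  shows "simulation_rel Act X x R \<longleftrightarrow>
    x \<in> erel_hom (R, X) (erel_power Act (codensity_lift (R, X)))"
proof -
  have R: "R \<subseteq> space X \<times> space X"
    using assms(2) by (simp add: erel_object_def)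
  have x: "x \<in> X \<rightarrow>\<^sub>M PiM Act (\<lambda>_. subprob_algebra X)"
    using assms(1) by (simp add: lmp_def)
  have x_space: "x s \<in> space (PiM Act (\<lambda>_. subprob_algebra X))" if "s \<in> space X" for s
    using measurable_space[OF x that] .
  then have xa: "x s a \<in> space (subprob_algebra X)" if "s \<in> space X" "a \<in> Act" for s a
    using that by (auto simp: space_PiM)
  have snd_lift: "snd (codensity_lift (R, X)) = subprob_algebra X"
    by (simp add: codensity_lift_def)
  \<comment> \<open>Measurability of \<open>x\<close> is the LMP condition, so being a morphism
    amounts to preserving the relation, tested label by label in the power.\<close>
  have "x \<in> erel_hom (R, X) (erel_power Act (codensity_lift (R, X))) \<longleftrightarrow>
    (\<forall>(s1, s2) \<in> R. \<forall>a \<in> Act. (x s1 a, x s2 a) \<in> fst (codensity_lift (R, X)))"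
    using x x_space R by (fastforce simp: erel_hom_def erel_power_def snd_lift Let_def)
  also have "\<dots> \<longleftrightarrow> (\<forall>(s1, s2) \<in> R. \<forall>a \<in> Act. \<forall>U \<in> sets X.
      R `` U = U \<longrightarrow> measure (x s1 a) U \<le> measure (x s2 a) U)"
    using R by (intro ball_cong refl) (auto simp: codensity_lift_iff[OF R assms(3)] xa)
  also have "\<dots> \<longleftrightarrow> simulation_rel Act X x R"
    using R assms(3) by (simp add: simulation_rel_def)
  finally show ?thesis ..
qed

end
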